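(* Assume that the boundary conditions $Cy(0)+Dy(1)=0$ split into $k$ conditions at $0$ and $n-k$ conditions at $1$. Then: (i) If $\operatorname{Re}(zB)$ is invertible and $\det T_{zB}(C,D)\neq0$, then $k=\kappa_+(\operatorname{Re}(zB))$. (ii) If the boundary conditions are regular, then $n=2k$ and $\kappa_+(\operatorname{Re}(zB))=\kappa_-(\operatorname{Re}(zB))$ for every admissible $z\in\mathbb{C}$, i.e. for those $z$ for which $\operatorname{Re}(zB)$ is invertible.
   Context: $B=\operatorname{diag}(b_1^{-1}I_{n_1},\dots,b_r^{-1}I_{n_r})\in\mathbb{C}^{n\times n}$, $n=n_1+\dots+n_r$, is a nonsingular diagonal matrix with complex entries, $b_j\neq b_k$ for $j\neq k$; $C,D\in\mathbb{C}^{n\times n}$ satisfy $\operatorname{rank}(C\ D)=n$. The conditions split into $k$ conditions at $0$ and $n-k$ at $1$ means that the last $n-k$ rows of $C$ and the first $k$ rows of $D$ are zero. For a diagonal matrix $A$, $\operatorname{Re}A$ denotes its (entrywise) real part $(A+A^* )/2$. $\kappa_+(A)$ and $\kappa_-(A)$ are the numbers of positive and negative eigenvalues (with multiplicity) of a selfadjoint matrix $A$. For a diagonal matrix $A=\operatorname{diag}(a_1,\dots,a_n)$ with $\operatorname{Re}a_k\neq0$ for all $k$, $T_A(C,D)$ is the $n\times n$ matrix whose $k$th column is the $k$th column of $C$ if $\operatorname{Re}a_k>0$ and the $k$th column of $D$ if $\operatorname{Re}a_k<0$. The boundary conditions are regular if and only if $\det T_{zB}(C,D)\neq0$ for every admissible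 $z$, i.e. for every $z\in\mathbb{C}$ such that $\operatorname{Re}(zB)$ is nonsingular. *)

theory Defs
  imports
    "Jordan_Normal_Form.Schur_Decomposition"
    "Jordan_Normal_Form.DL_Rank"
begin

text \<open>Throughout, matrices are complex with rows and columns
  indexed from 0, and the boundary conditions \<open>C y(0) + D y(1) = 0\<close> are represented by
  the pair \<open>C\<close>, \<open>D\<close>.\<close>

definition block_diagonal_B :: "nat \<Rightarrow> (nat \<Rightarrow> nat) \<Rightarrow> (nat \<Rightarrow> complex) \<Rightarrow> complex mat" where
  "block_diagonal_B r ns b =
     diag_block_mat (map (\<lambda>j. inverse (b j) \<cdot>\<^sub>m 1\<^sub>m (ns j)) [0..<r])"

definition Re_mat :: "complex mat \<Rightarrow> complex mat" where
  "Re_mat A = (1 / 2) \<cdot>\<^sub>m (A + mat_adjoint A)"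

text \<open>Eigenvalues are counted with algebraic multiplicity, which agrees with the geometric one
  for selfadjoint matrices. The eigenvalues of a selfadjoint matrix are real, so it suffices to
  let the index of summation range over the reals; the index set is finite since an eigenvalue
  is a root of the characteristic polynomial.\<close>

definition kappa_plus :: "complex mat \<Rightarrow> nat" where
  "kappa_plus A =
     (\<Sum>x \<in> {x::real. 0 < x \<and> eigenvalue A (complex_of_real x)}. order (complex_of_real x) (char_poly A))"

definition kappa_minus :: "complex mat \<Rightarrow> nat" where
  "kappa_minus A =
     (\<Sum>x \<in> {x::real. x < 0 \<and> eigenvalue A (complex_of_real x)}. order (complex_of_real x) (char_poly A))"

definition admissible :: "complex mat \<Rightarrow> complex \<Rightarrow> bool" where
  "admissible B z \<longleftrightarrow> invertible_mat (Re_mat (z \<cdot>\<^sub>m B))"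

text \<open>Only meaningful when all diagonal entries of \<open>A\<close> have nonzero real part, so that the
  else branch is the case of a negative real part.\<close>

definition T_mat :: "complex mat \<Rightarrow> complex mat \<Rightarrow> complex mat \<Rightarrow> complex mat" where
  "T_mat A C D =
     mat (dim_row A) (dim_row A) (\<lambda>(i, k). if Re (A $$ (k, k)) > 0 then C $$ (i, k) else D $$ (i, k))"

definition regular_bc :: "complex mat \<Rightarrow> complex mat \<Rightarrow> complex mat \<Rightarrow> bool" where
  "regular_bc B C D \<longleftrightarrow> (\<forall>z. admissible B z \<longrightarrow> det (T_mat (z \<cdot>\<^sub>m B) C D) \<noteq> 0)"

definition bc_rank :: "complex mat \<Rightarrow> complex mat \<Rightarrow> nat" where
  "bc_rank C D = vec_space.rank (dim_row C) (mat_of_cols (dim_row C) (cols C @ cols D))"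

text \<open>\<open>k\<close> conditions at 0 and \<open>n - k\<close> conditions at 1, where \<open>n\<close> is the number of rows:
  the last \<open>n - k\<close> rows of \<open>C\<close> and the first \<open>k\<close> rows of \<open>D\<close> vanish. The subtraction
  \<open>n - k\<close> presupposes \<open>k \<le> n\<close>.\<close>

definition bc_split :: "nat \<Rightarrow> complex mat \<Rightarrow> complex mat \<Rightarrow> bool" where
  "bc_split k C D \<longleftrightarrow>
     k \<le> dim_row C \<and>
     (\<forall>i. k \<le> i \<and> i < dim_row C \<longrightarrow> row C i = 0\<^sub>v (dim_col C)) \<and>
     (\<forall>i < k. row D i = 0\<^sub>v (dim_col D))"

end

theory Submission
  imports Defs
begin

text \<open>Everything is diagonal, so \<open>\<kappa>\<^sub>+\<close> counts the columns of \<open>T\<close> taken from \<open>C\<close>. If \<open>det T \<noteq> 0\<close>,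
  then some term of the Leibniz expansion is nonzero, and the zero rows of \<open>C\<close> and \<open>D\<close> force its
  permutation to map the first \<open>k\<close> rows exactly onto those columns; this gives (i). For (ii), some
  line through 0 contains admissible \<open>z\<close>, and (i) applies to both \<open>z\<close> and \<open>-z\<close>, which have their
  \<open>\<kappa>\<^sub>+\<close> and \<open>\<kappa>\<^sub>-\<close> exchanged.\<close>

lemma dim_mat_diag [simp]: "dim_row (mat_diag n f) = n" "dim_col (mat_diag n f) = n"
  by (simp_all add: mat_diag_def)

lemma smult_mat_diag:
  fixes a :: "'a::semiring_0"
  shows "a \<cdot>\<^sub>m mat_diag n f = mat_diag n (\<lambda>i. a * f i)"
  by (rule eq_matI) (auto simp: mat_diag_def)

lemma invertible_mat_diag_iff:
  fixes f :: "nat \<Rightarrow> 'a::field"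
  shows "invertible_mat (mat_diag n f) \<longleftrightarrow> (\<forall>i<n. f i \<noteq> 0)"
proof
  assume "invertible_mat (mat_diag n f)"
  then obtain E where E: "mat_diag n f * E = 1\<^sub>m n" "E * mat_diag n f = 1\<^sub>m (dim_row E)"
    by (auto simp: invertible_mat_def inverts_mat_def)
  \<comment> \<open>\<open>invertible_mat\<close> does not fix the shape of the inverse; comparing
    the column counts of both products recovers it.\<close>
  have Ec: "E \<in> carrier_mat n n"
    using arg_cong[OF E(1), of dim_col] arg_cong[OF E(2), of dim_col] by (intro carrier_matI) simp_all
  show "\<forall>i<n. f i \<noteq> 0"
  proof (intro allI impI notI)
    fix i assume i: "i < n" "f i = 0"
    have "(mat_diag n f * E) $$ (i, i) = f i * E $$ (i, i)"
      using i by (simp add: mat_diag_mult_left[OF Ec])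
    then show False using E(1) i by simp
  qed
next
  assume nz: "\<forall>i<n. f i \<noteq> 0"
  have "mat_diag n (\<lambda>i. f i * inverse (f i)) = 1\<^sub>m n"
    using nz by (intro eq_matI) (auto simp: mat_diag_def)
  then show "invertible_mat (mat_diag n f)"
    unfolding invertible_mat_def inverts_mat_def
    by (auto intro!: exI[of _ "mat_diag n (\<lambda>i. inverse (f i))"] simp: mult.commute)
qed

text \<open>The characteristic polynomial splits into the linear factors of the diagonal entries,
  and orders add over products: a factor contributes 1 if its entry is \<open>x\<close> and 0
  otherwise.\<close>

lemma order_char_poly_mat_diag:
  fixes f :: "nat \<Rightarrow> 'a::field"
  shows "order x (char_poly (mat_diag n f)) = card {i. i < n \<and> f i = x}"
proof -
  have "char_poly (mat_diag n f) = (\<Prod>a\<leftarrow>diag_mat (mat_diag n f). [:- a, 1:])"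
    by (rule char_poly_upper_triangular[of _ n]) (auto simp: mat_diag_def)
  also have "\<dots> = (\<Prod>i\<leftarrow>[0..<n]. [:- f i, 1:])"
    by (intro arg_cong[of _ _ prod_list]) (auto simp: diag_mat_def mat_diag_def)
  also have "order x \<dots> = (\<Sum>i\<leftarrow>[0..<n]. if f i = x then 1 else 0)"
    by (subst order_prod_list) (auto simp: o_def order_linear' intro!: arg_cong[of _ _ sum_list])
  also have "\<dots> = (\<Sum>i<n. if f i = x then 1 else 0)"
    by (simp add: interv_sum_list_conv_sum_set_nat atLeast0LessThan)
  also have "\<dots> = card {i. i < n \<and> f i = x}"
    by (simp add: sum.If_cases Int_def)
  finally show ?thesis .
qed

text \<open>The order at \<open>x\<close> is the size of the fibre of \<open>g\<close> over
  \<open>x\<close>, and \<open>x\<close> is an eigenvalue exactly when that fibre is nonempty.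
  Summing fibre sizes counts indices. The predicate \<open>P\<close> lets one argument serve both
  signs.\<close>

lemma sum_order_mat_diag_real:
  fixes g :: "nat \<Rightarrow> real" and n :: nat
  defines "A \<equiv> mat_diag n (\<lambda>i. complex_of_real (g i))"
  shows "(\<Sum>x \<in> {x. P x \<and> eigenvalue A (complex_of_real x)}. order (complex_of_real x) (char_poly A))
    = card {i. i < n \<and> P (g i)}"
proof -
  have order: "order (complex_of_real x) (char_poly A) = card {i. i < n \<and> g i = x}" for x
    by (simp add: A_def order_char_poly_mat_diag)
  have A: "A \<in> carrier_mat n n" by (simp add: A_def)
  have "eigenvalue A (complex_of_real x) \<longleftrightarrow> x \<in> g ` {..<n}" for x
  proof -
    \<comment> \<open>Only for a nonzero polynomial does being a root amount to having nonzero
      order.\<close>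
    have "char_poly A \<noteq> 0" using degree_monic_char_poly[OF A] by auto
    then have "eigenvalue A (complex_of_real x) \<longleftrightarrow> card {i. i < n \<and> g i = x} \<noteq> 0"
      by (metis order eigenvalue_root_char_poly[OF A] order_root)
    then show ?thesis by auto
  qed
  then have index: "{x. P x \<and> eigenvalue A (complex_of_real x)} = g ` {i. i < n \<and> P (g i)}"
    by auto
  have "card {i. i < n \<and> P (g i)}
      = (\<Sum>x \<in> g ` {i. i < n \<and> P (g i)}. card {i \<in> {i. i < n \<and> P (g i)}. g i = x})"
    using sum.image_gen[of "{i. i < n \<and> P (g i)}" "\<lambda>_. 1::nat" g] by simp
  also have "\<dots> = (\<Sum>x \<in> g ` {i. i < n \<and> P (g i)}. card {i. i < n \<and> g i = x})"
    by (rule sum.cong) (auto intro!: arg_cong[of _ _ card])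
  finally show ?thesis unfolding index order by simp
qed

lemma kappa_plus_mat_diag:
  "kappa_plus (mat_diag n (\<lambda>i. complex_of_real (g i))) = card {i. i < n \<and> 0 < g i}"
  unfolding kappa_plus_def by (rule sum_order_mat_diag_real)

lemma kappa_minus_mat_diag:
  "kappa_minus (mat_diag n (\<lambda>i. complex_of_real (g i))) = card {i. i < n \<and> g i < 0}"
  unfolding kappa_minus_def by (rule sum_order_mat_diag_real)

text \<open>The entries are written as embedded reals to match the diagonal matrices whose positive
  and negative eigenvalues are counted above.\<close>

lemma Re_mat_mat_diag: "Re_mat (mat_diag n f) = mat_diag n (\<lambda>i. complex_of_real (Re (f i)))"
  unfolding Re_mat_def
  by (rule eq_matI)
    (auto simp: mat_diag_def mat_adjoint_def mat_of_rows_def complex_eq_iff)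

text \<open>This reduces \<open>B\<close> to one diagonal matrix. The entries stay abstract: later
  steps use only that they inherit a property \<open>P\<close> of the block scalars, namely being
  nonzero. An arbitrary list \<open>js\<close> makes induction on the blocks possible.\<close>

lemma diag_block_mat_scalar_blocks:
  fixes c :: "nat \<Rightarrow> 'a::comm_ring_1"
  assumes "\<And>j. j \<in> set js \<Longrightarrow> P (c j)"
  obtains d where "diag_block_mat (map (\<lambda>j. c j \<cdot>\<^sub>m 1\<^sub>m (ns j)) js) = mat_diag (sum_list (map ns js)) d"
    and "\<And>i. i < sum_list (map ns js) \<Longrightarrow> P (d i)"
proof -
  have "\<exists>d. diag_block_mat (map (\<lambda>j. c j \<cdot>\<^sub>m 1\<^sub>m (ns j)) js) = mat_diag (sum_list (map ns js)) d
      \<and> (\<forall>i < sum_list (map ns js). P (d i))"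
    using assms
  proof (induction js)
    case Nil
    have "0\<^sub>m 0 0 = mat_diag 0 c" by (rule eq_matI) simp_all
    then show ?case by auto
  next
    case (Cons j js)
    then obtain d where d: "diag_block_mat (map (\<lambda>j. c j \<cdot>\<^sub>m 1\<^sub>m (ns j)) js)
        = mat_diag (sum_list (map ns js)) d" "\<forall>i < sum_list (map ns js). P (d i)"
      by auto
    \<comment> \<open>The first block occupies \<open>ns j\<close> positions, so the entries of the
      remaining blocks are shifted by that amount.\<close>
    let ?d = "\<lambda>i. if i < ns j then c j else d (i - ns j)"
    have "diag_block_mat (map (\<lambda>j. c j \<cdot>\<^sub>m 1\<^sub>m (ns j)) (j # js))
        = mat_diag (sum_list (map ns (j # js))) ?d"
      by (rule eq_matI) (auto simp: d(1) Let_def mat_diag_def)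
    moreover have "\<forall>i < sum_list (map ns (j # js)). P (?d i)"
      using d(2) Cons.prems by auto
    ultimately show ?case by blast
  qed
  then show ?thesis using that by blast
qed

text \<open>This isolates the combinatorics of \<open>T_mat\<close>: \<open>Q\<close> marks the
  columns taken from \<open>C\<close>, and the two vanishing conditions are the zero rows of
  \<open>D\<close> and \<open>C\<close>.\<close>

lemma det_nonzero_imp_card_cols:
  fixes A :: "'a::idom mat"
  assumes A: "A \<in> carrier_mat n n" and "det A \<noteq> 0" and "k \<le> n"
    and upper: "\<And>i j. i < k \<Longrightarrow> j < n \<Longrightarrow> \<not> Q j \<Longrightarrow> A $$ (i, j) = 0"
    and lower: "\<And>i j. k \<le> i \<Longrightarrow> i < n \<Longrightarrow> j < n \<Longrightarrow> Q j \<Longrightarrow> A $$ (i, j) = 0"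
  shows "k = card {j. j < n \<and> Q j}"
proof -
  obtain p where p: "p permutes {0..<n}" and "(\<Prod>i = 0..<n. A $$ (i, p i)) \<noteq> 0"
  proof (rule ccontr)
    assume "\<not> thesis"
    with that have "(\<Prod>i = 0..<n. A $$ (i, p i)) = 0" if "p permutes {0..<n}" for p
      using that by blast
    then have "det A = 0" unfolding det_def'[OF A] by (intro sum.neutral) simp
    with \<open>det A \<noteq> 0\<close> show False by simp
  qed
  then have nz: "A $$ (i, p i) \<noteq> 0" if "i < n" for i using that by auto
  have p_lt: "p i < n" if "i < n" for i using permutes_in_image[OF p] that by simp
  \<comment> \<open>The entry at \<open>(i, p i)\<close> is nonzero, so \<open>upper\<close> rules
    out an unmarked column for \<open>i < k\<close> and \<open>lower\<close> a marked one for the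
    other rows.\<close>
  have Q_p: "Q (p i) \<longleftrightarrow> i < k" if "i < n" for i
    using nz[OF that] upper[of i "p i"] lower[of i "p i"] p_lt[OF that] that by force
  have "p ` {..<k} = {j. j < n \<and> Q j}"
  proof safe
    fix j assume j: "j < n" "Q j"
    then have "j \<in> p ` {0..<n}" using permutes_image[OF p] by simp
    then show "j \<in> p ` {..<k}" using Q_p j by auto
  qed (use \<open>k \<le> n\<close> p_lt Q_p in auto)
  moreover have "card (p ` {..<k}) = k"
    using card_image[of p "{..<k}"] permutes_inj[OF p] by (simp add: inj_on_def inj_def)
  ultimately show ?thesis by simp
qed

text \<open>Along \<open>z = Complex 1 t\<close> the real part of \<open>z * d i\<close> is
  \<open>Re (d i) - t * Im (d i)\<close>. Each nonzero \<open>d i\<close> excludes at most one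
  \<open>t\<close>, so finitely many of them leave some \<open>t\<close> free.\<close>

lemma exists_Re_mult_nonzero:
  assumes "finite I" and "\<And>i. i \<in> I \<Longrightarrow> d i \<noteq> 0"
  obtains z where "\<And>i. i \<in> I \<Longrightarrow> Re (z * d i) \<noteq> 0"
proof -
  \<comment> \<open>If \<open>Im (d i) = 0\<close>, the quotient is 0 by convention, which merely
    excludes \<open>t = 0\<close>.\<close>
  have "finite ((\<lambda>i. Re (d i) / Im (d i)) ` I)" using assms(1) by simp
  then obtain t where t: "t \<notin> (\<lambda>i. Re (d i) / Im (d i)) ` I"
    using ex_new_if_finite[OF infinite_UNIV_char_0] by blast
  have "Re (Complex 1 t * d i) \<noteq> 0" if "i \<in> I" for i
  proof
    assume eq: "Re (Complex 1 t * d i) = 0"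
    then have "Im (d i) \<noteq> 0" using assms(2)[OF that] by (auto simp: complex_eq_iff)
    then have "t = Re (d i) / Im (d i)" using eq by (simp add: field_simps)
    then show False using t that by blast
  qed
  then show ?thesis using that by blast
qed

theorem lemma3p5:
  fixes r n k :: nat
    and ns :: "nat \<Rightarrow> nat"
    and b :: "nat \<Rightarrow> complex"
    and B C D :: "complex mat"
  assumes "n = (\<Sum>j<r. ns j)"
    and "\<And>j. j < r \<Longrightarrow> b j \<noteq> 0"
    and "inj_on b {..<r}"
    and "B = block_diagonal_B r ns b"
    and "C \<in> carrier_mat n n"
    and "D \<in> carrier_mat n n"
    and "bc_rank C D = n"
    and "bc_split k C D"
  shows "(\<forall>z. invertible_mat (Re_mat (z \<cdot>\<^sub>m B)) \<and> det (T_mat (z \<cdot>\<^sub>m B) C D) \<noteq> 0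
            \<longrightarrow> k = kappa_plus (Re_mat (z \<cdot>\<^sub>m B)))
       \<and> (regular_bc B C D
            \<longrightarrow> n = 2 * k \<and>
              (\<forall>z. admissible B z \<longrightarrow>
                 kappa_plus (Re_mat (z \<cdot>\<^sub>m B)) = kappa_minus (Re_mat (z \<cdot>\<^sub>m B))))"
proof -
  have "sum_list (map ns [0..<r]) = n"
    using assms(1) by (simp add: interv_sum_list_conv_sum_set_nat atLeast0LessThan)
  then obtain d where B: "B = mat_diag n d" and d: "\<And>i. i < n \<Longrightarrow> d i \<noteq> 0"
    using diag_block_mat_scalar_blocks[of "[0..<r]" "\<lambda>x. x \<noteq> 0" "\<lambda>j. inverse (b j)" ns] assms(2)
    unfolding assms(4) block_diagonal_B_def by auto
  have Re_zB: "Re_mat (z \<cdot>\<^sub>m B) = mat_diag n (\<lambda>i. complex_of_real (Re (z * d i)))" for z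
    unfolding B smult_mat_diag Re_mat_mat_diag ..
  have adm: "admissible B z \<longleftrightarrow> (\<forall>i<n. Re (z * d i) \<noteq> 0)" for z
    unfolding admissible_def Re_zB invertible_mat_diag_iff of_real_eq_0_iff ..
  have plus: "kappa_plus (Re_mat (z \<cdot>\<^sub>m B)) = card {i. i < n \<and> 0 < Re (z * d i)}" for z
    unfolding Re_zB kappa_plus_mat_diag ..
  have minus: "kappa_minus (Re_mat (z \<cdot>\<^sub>m B)) = card {i. i < n \<and> Re (z * d i) < 0}" for z
    unfolding Re_zB kappa_minus_mat_diag ..
  have k: "k \<le> n" using assms(5,8) by (auto simp: bc_split_def)
  have C_zero: "C $$ (i, j) = 0" if "k \<le> i" "i < n" "j < n" for i j
  proof -
    have "row C i $ j = 0" using assms(5,8) that by (simp add: bc_split_def)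
    then show ?thesis using assms(5) that by simp
  qed
  have D_zero: "D $$ (i, j) = 0" if "i < k" "j < n" for i j
  proof -
    have "row D i $ j = 0" using assms(6,8) that by (simp add: bc_split_def)
    then show ?thesis using assms(6) that k by simp
  qed
  \<comment> \<open>\<open>T_mat\<close> chooses its columns by the same sign test that
    \<open>kappa_plus\<close> counts, so that test is taken as \<open>Q\<close>.\<close>
  have part1: "k = kappa_plus (Re_mat (z \<cdot>\<^sub>m B))" if "det (T_mat (z \<cdot>\<^sub>m B) C D) \<noteq> 0" for z
    unfolding plus
  proof (rule det_nonzero_imp_card_cols[OF _ that k])
    show "T_mat (z \<cdot>\<^sub>m B) C D \<in> carrier_mat n n" by (simp add: T_mat_def B)
    show "T_mat (z \<cdot>\<^sub>m B) C D $$ (i, j) = 0" if "i < k" "j < n" "\<not> 0 < Re (z * d j)" for i j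
      using that k D_zero by (simp add: T_mat_def B mat_diag_def)
    show "T_mat (z \<cdot>\<^sub>m B) C D $$ (i, j) = 0" if "k \<le> i" "i < n" "j < n" "0 < Re (z * d j)" for i j
      using that C_zero by (simp add: T_mat_def B mat_diag_def)
  qed
  have part2: "kappa_plus (Re_mat (z \<cdot>\<^sub>m B)) = k \<and> kappa_minus (Re_mat (z \<cdot>\<^sub>m B)) = k"
    if reg: "regular_bc B C D" and z: "admissible B z" for z
  proof
    show "kappa_plus (Re_mat (z \<cdot>\<^sub>m B)) = k"
      using part1[symmetric] reg z unfolding regular_bc_def by blast
    \<comment> \<open>Passing to \<open>- z\<close> flips the sign of every diagonal entry: none
      becomes zero, and the positive entries at \<open>- z\<close> are the negative ones at
      \<open>z\<close>.\<close>
    have "admissible B (- z)" using z unfolding adm mult_minus_left uminus_complex.sel neg_equal_0_iff_equal .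
    then have "k = kappa_plus (Re_mat (- z \<cdot>\<^sub>m B))" using part1 reg unfolding regular_bc_def by blast
    also have "\<dots> = kappa_minus (Re_mat (z \<cdot>\<^sub>m B))"
      unfolding plus minus by (rule arg_cong[of _ _ card]) auto
    finally show "kappa_minus (Re_mat (z \<cdot>\<^sub>m B)) = k" ..
  qed
  have "n = 2 * k" if reg: "regular_bc B C D"
  proof -
    \<comment> \<open>Regularity quantifies over admissible points, so one must be exhibited before
      it says anything about \<open>n\<close>.\<close>
    obtain z where z: "\<And>i. i \<in> {..<n} \<Longrightarrow> Re (z * d i) \<noteq> 0"
      using exists_Re_mult_nonzero[of "{..<n}" d] d by auto
    have "admissible B z" unfolding adm using z by simp
    then have "card {i. i < n \<and> 0 < Re (z * d i)} + card {i. i < n \<and> Re (z * d i) < 0} = 2 * k"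
      using part2[OF reg] unfolding plus minus by simp
    moreover have "card {i. i < n \<and> 0 < Re (z * d i)} + card {i. i < n \<and> Re (z * d i) < 0}
        = card ({i. i < n \<and> 0 < Re (z * d i)} \<union> {i. i < n \<and> Re (z * d i) < 0})"
      by (rule card_Un_disjoint[symmetric]) auto
    \<comment> \<open>As no entry has zero real part, the two sign classes exhaust all
      \<open>n\<close> indices.\<close>
    moreover have "{i. i < n \<and> 0 < Re (z * d i)} \<union> {i. i < n \<and> Re (z * d i) < 0} = {..<n}"
      using z by (force simp: neq_iff)
    ultimately show ?thesis by simp
  qed
  then show ?thesis using part1 part2 by simp
qed

end
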